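(* Let $L_n(t)$ denote the Laguerre polynomials. The sequence $(L_n(t))_{n\ge 0}$ is log-concave for every real $t\le 0$. For every real $t<0$, the ratio $L_n(t)/L_{n-1}(t)$ is greater than $1$ for all $n\ge1$, and it tends to $1$ decreasingly as $n\to\infty$.
   Context: The (ordinary) Laguerre polynomials are defined by $L_0(t)=1$, $L_1(t)=1-t$, and $nL_n(t)=(2n-1-t)L_{n-1}(t)-(n-1)L_{n-2}(t)$ for $n\ge 2$. A sequence $(a(n))_{n\ge 0}$ of real numbers is log-concave if $a(n)^2\ge a(n-1)a(n+1)$ for all $n\ge 1$. *)

theory Defs
  imports Complex_Main "HOL-Computational_Algebra.Polynomial"
begin

text \<open>
  The recurrence \<open>n L\<^sub>n(t) = (2n - 1 - t) L\<^sub>n\<^sub>-\<^sub>1(t) - (n - 1) L\<^sub>n\<^sub>-\<^sub>2(t)\<close>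
  at index \<open>n + 2\<close>, solved for the leading term.
\<close>
fun laguerre :: "nat \<Rightarrow> real poly" where
  "laguerre 0 = 1"
| "laguerre (Suc 0) = [:1, -1:]"
| "laguerre (Suc (Suc n)) =
     smult (1 / real (n + 2))
       ([:2 * real (n + 2) - 1, -1:] * laguerre (n + 1)
        - smult (real (n + 2) - 1) (laguerre n))"

lemma laguerre_recurrence:
  assumes "n \<ge> 2"
  shows "real n * poly (laguerre n) t =
           (2 * real n - 1 - t) * poly (laguerre (n - 1)) t
           - (real n - 1) * poly (laguerre (n - 2)) t"
proof -
  obtain m where "n = Suc (Suc m)"
    using assms by (metis add_2_eq_Suc le_Suc_ex)
  then show ?thesis
    by (simp add: field_simps)
qed

definition log_concave :: "(nat \<Rightarrow> real) \<Rightarrow> bool" where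
  "log_concave a \<longleftrightarrow> (\<forall>n\<ge>1. (a n)\<^sup>2 \<ge> a (n - 1) * a (n + 1))"

end

theory Submission imports Defs "HOL-Real_Asymp.Real_Asymp" begin

text \<open>
  Log-concavity follows from a recursion for the Turan expression
  \<open>D\<^sub>n = L\<^sub>n\<^sub>+\<^sub>1\<^sup>2 - L\<^sub>n L\<^sub>n\<^sub>+\<^sub>2\<close>, namely
  \<open>(n + 3) D\<^sub>n\<^sub>+\<^sub>1 = (n + 1) D\<^sub>n + (L\<^sub>n\<^sub>+\<^sub>2 - L\<^sub>n\<^sub>+\<^sub>1)\<^sup>2\<close>, which shows
  \<open>D\<^sub>n \<ge> 0\<close> by induction. For \<open>t < 0\<close> the three-term recurrence, written for the
  differences \<open>L\<^sub>n\<^sub>+\<^sub>1 - L\<^sub>n\<close>, shows that \<open>L\<^sub>n(t)\<close> is positive and strictly increasing. The ratios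
  therefore decrease to some limit \<open>l \<ge> 1\<close>, and the recurrence divided by \<open>n\<close> gives
  \<open>l = 2 - 1 / l\<close>, so \<open>l = 1\<close>.
\<close>

lemma poly_laguerre_Suc_Suc:
  "(real n + 2) * poly (laguerre (Suc (Suc n))) t =
     (2 * real n + 3 - t) * poly (laguerre (Suc n)) t - (real n + 1) * poly (laguerre n) t"
  using laguerre_recurrence[of "Suc (Suc n)" t] by (simp add: algebra_simps)

lemma laguerre_turan_recursion:
  fixes t :: real
  defines "a \<equiv> \<lambda>n. poly (laguerre n) t"
  shows "(real n + 3) * ((a (n + 2))\<^sup>2 - a (n + 1) * a (n + 3)) =
           (real n + 1) * ((a (n + 1))\<^sup>2 - a n * a (n + 2)) + (a (n + 2) - a (n + 1))\<^sup>2"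
proof -
  have r1: "(real n + 2) * a (n + 2) = (2 * real n + 3 - t) * a (n + 1) - (real n + 1) * a n"
    using poly_laguerre_Suc_Suc[of n t] unfolding a_def by (simp del: laguerre.simps)
  have r2: "(real n + 3) * a (n + 3) = (2 * real n + 5 - t) * a (n + 2) - (real n + 2) * a (n + 1)"
    using poly_laguerre_Suc_Suc[of "Suc n" t] unfolding a_def
    by (simp del: laguerre.simps add: eval_nat_numeral algebra_simps)
  \<comment> \<open>\<open>r1\<close> times \<open>a (n + 2)\<close> minus \<open>r2\<close> times
    \<open>a (n + 1)\<close> eliminates \<open>t\<close>; the mixed term left over,
    \<open>- 2 * a (n + 1) * a (n + 2)\<close>, completes the square.\<close>
  from r1 r2 show ?thesis
    by algebra
qed

lemma laguerre_turan_nonneg: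
  "poly (laguerre n) t * poly (laguerre (n + 2)) t \<le> (poly (laguerre (n + 1)) t)\<^sup>2"
proof (induction n)
  case 0
  have "2 * ((1 - t)\<^sup>2 - poly (laguerre 2) t) = t\<^sup>2"
    using poly_laguerre_Suc_Suc[of 0 t]
    by (simp add: eval_nat_numeral algebra_simps del: laguerre.simps(3))
  then have "2 * ((1 - t)\<^sup>2 - poly (laguerre 2) t) \<ge> 0"
    by simp
  then show ?case
    by (simp add: numeral_2_eq_2 del: laguerre.simps(3))
next
  case (Suc n)
  have "0 \<le> (real n + 3) *
    ((poly (laguerre (n + 2)) t)\<^sup>2 - poly (laguerre (n + 1)) t * poly (laguerre (n + 3)) t)"
    unfolding laguerre_turan_recursion using Suc.IH by simp
  then have "0 \<le> (poly (laguerre (n + 2)) t)\<^sup>2 - poly (laguerre (n + 1)) t * poly (laguerre (n + 3)) t"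
    by (simp add: zero_le_mult_iff del: laguerre.simps)
  then show ?case
    by (simp add: eval_nat_numeral del: laguerre.simps)
qed

lemma log_concave_laguerre: "log_concave (\<lambda>n. poly (laguerre n) t)"
  unfolding log_concave_def
proof (intro allI impI)
  fix n :: nat assume "n \<ge> 1"
  then obtain m where "n = Suc m"
    by (cases n) auto
  then show "(poly (laguerre n) t)\<^sup>2 \<ge> poly (laguerre (n - 1)) t * poly (laguerre (n + 1)) t"
    using laguerre_turan_nonneg[of m t] by (simp del: laguerre.simps)
qed

text \<open>Positivity and growth need a joint induction: the next increment combines
  \<open>- t\<close> times a value with a positive multiple of the previous increment.\<close>

lemma laguerre_pos_less_Suc:
  assumes "t < 0"
  shows "0 < poly (laguerre n) t \<and> poly (laguerre n) t < poly (laguerre (Suc n)) t"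
proof (induction n)
  case 0
  then show ?case using assms by simp
next
  case (Suc n)
  let ?a = "\<lambda>n. poly (laguerre n) t"
  have "(real n + 2) * (?a (Suc (Suc n)) - ?a (Suc n)) =
      - t * ?a (Suc n) + (real n + 1) * (?a (Suc n) - ?a n)"
    using poly_laguerre_Suc_Suc[of n t] by (simp add: algebra_simps del: laguerre.simps)
  also have "\<dots> > 0"
  proof (rule add_pos_pos)
    show "0 < - t * ?a (Suc n)"
      using Suc.IH assms by (intro mult_pos_pos) linarith+
    show "0 < (real n + 1) * (?a (Suc n) - ?a n)"
      using Suc.IH by (intro mult_pos_pos) linarith+
  qed
  finally have "?a (Suc (Suc n)) > ?a (Suc n)"
    by (simp add: zero_less_mult_iff del: laguerre.simps)
  then show ?case
    using Suc.IH by linarith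
qed

text \<open>This is the Turan inequality divided by the positive product of two consecutive
  values.\<close>

lemma laguerre_ratio_decseq:
  assumes "t < 0"
  shows "decseq (\<lambda>n. poly (laguerre (Suc n)) t / poly (laguerre n) t)"
proof (rule decseq_SucI)
  fix n
  show "poly (laguerre (Suc (Suc n))) t / poly (laguerre (Suc n)) t
      \<le> poly (laguerre (Suc n)) t / poly (laguerre n) t"
    using laguerre_turan_nonneg[of n t] laguerre_pos_less_Suc[OF assms, of n]
    by (simp add: divide_simps power2_eq_square mult.commute del: laguerre.simps)
qed

lemma laguerre_ratio_tendsto:
  assumes "t < 0"
  shows "(\<lambda>n. poly (laguerre (Suc n)) t / poly (laguerre n) t) \<longlonglongrightarrow> 1"
proof -
  define e where "e = (\<lambda>n. poly (laguerre (Suc n)) t / poly (laguerre n) t)"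
  have ge1: "1 \<le> e n" for n
    using laguerre_pos_less_Suc[OF assms, of n] unfolding e_def
    by (simp add: divide_simps del: laguerre.simps)
  obtain l where l: "e \<longlonglongrightarrow> l"
    using decseq_convergent[of e 1] laguerre_ratio_decseq[OF assms] ge1
    unfolding e_def by blast
  \<comment> \<open>Besides bounding the limit, this keeps \<open>l\<close> away from 0, so that
    \<open>1 / e n\<close> converges to \<open>1 / l\<close>.\<close>
  have l1: "1 \<le> l"
    using LIMSEQ_le_const[OF l] ge1 by blast
  have rec: "e (Suc n) = (2 * real n + 3 - t) / (real n + 2) - (real n + 1) / (real n + 2) * (1 / e n)" for n
  proof -
    have pos: "0 < poly (laguerre (Suc n)) t"
      using laguerre_pos_less_Suc[OF assms] by blast
    have pos': "0 < real n + 2"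
      by simp
    \<comment> \<open>Division of the recurrence by \<open>z * b\<close>. The identity
      \<open>1 / (b / a) = a / b\<close> also covers \<open>a = 0\<close>, where both sides are
      0.\<close>
    have *: "c / b = x / z - y / z * (1 / (b / a))" if "z * c = x * b - y * a" "b > 0" "z > 0"
      for a b c x y z :: real
    proof -
      have "c = (x * b - y * a) / z"
        using that by (simp add: eq_divide_eq mult.commute)
      then show ?thesis
        using that by (simp add: diff_divide_distrib)
    qed
    show ?thesis
      unfolding e_def by (rule *[OF poly_laguerre_Suc_Suc pos pos'])
  qed
  have "(\<lambda>n. (2 * real n + 3 - t) / (real n + 2)) \<longlonglongrightarrow> 2"
    by real_asymp
  moreover have "(\<lambda>n. (real n + 1) / (real n + 2)) \<longlonglongrightarrow> 1"
    by real_asymp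
  moreover have "(\<lambda>n. 1 / e n) \<longlonglongrightarrow> 1 / l"
    using l l1 by (intro tendsto_intros) auto
  ultimately have "(\<lambda>n. e (Suc n)) \<longlonglongrightarrow> 2 - 1 * (1 / l)"
    unfolding rec by (intro tendsto_diff tendsto_mult)
  then have "l = 2 - 1 * (1 / l)"
    by (rule LIMSEQ_unique[OF LIMSEQ_Suc[OF l]])
  \<comment> \<open>Clearing the denominator turns the fixed-point equation into a quadratic with
    double root 1.\<close>
  then have "l * l = l * (2 - 1 * (1 / l))"
    by (rule arg_cong)
  also have "\<dots> = 2 * l - 1"
    using l1 by (simp add: right_diff_distrib)
  finally have "(l - 1)\<^sup>2 = 0"
    by (simp add: power2_eq_square algebra_simps)
  then show ?thesis
    using l unfolding e_def by simp
qed

theorem theorem4p16: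
  "(\<forall>t::real. t \<le> 0 \<longrightarrow> log_concave (\<lambda>n. poly (laguerre n) t)) \<and>
   (\<forall>t::real. t < 0 \<longrightarrow>
      (\<forall>n\<ge>1. poly (laguerre n) t / poly (laguerre (n - 1)) t > 1) \<and>
      antimono_on {1..} (\<lambda>n. poly (laguerre n) t / poly (laguerre (n - 1)) t) \<and>
      (\<lambda>n. poly (laguerre n) t / poly (laguerre (n - 1)) t) \<longlonglongrightarrow> 1)"
proof (intro conjI allI impI)
  show "log_concave (\<lambda>n. poly (laguerre n) t)" for t
    by (rule log_concave_laguerre)
next
  fix t :: real and n :: nat assume "t < 0" "n \<ge> 1"
  then show "poly (laguerre n) t / poly (laguerre (n - 1)) t > 1"
    using laguerre_pos_less_Suc[of t "n - 1"] by (simp del: laguerre.simps)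
next
  fix t :: real assume t: "t < 0"
  show "antimono_on {1..} (\<lambda>n. poly (laguerre n) t / poly (laguerre (n - 1)) t)"
  \<comment> \<open>Index 0 lies outside \<open>{1..}\<close>: there \<open>n - 1\<close> truncates
    to 0 and the term is 1, below the term at index 1.\<close>
  proof (rule monotone_onI)
    fix m n :: nat assume "m \<in> {1..}" "n \<in> {1..}" "m \<le> n"
    then show "poly (laguerre m) t / poly (laguerre (m - 1)) t
        \<ge> poly (laguerre n) t / poly (laguerre (n - 1)) t"
      using decseqD[OF laguerre_ratio_decseq[OF t], of "m - 1" "n - 1"]
      by (simp del: laguerre.simps)
  qed
  show "(\<lambda>n. poly (laguerre n) t / poly (laguerre (n - 1)) t) \<longlonglongrightarrow> 1"
    \<comment> \<open>The shift by one drops that exceptional term at index 0.\<close>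
    by (rule LIMSEQ_imp_Suc) (use laguerre_ratio_tendsto[OF t] in \<open>simp del: laguerre.simps\<close>)
qed

end
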